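(* Let $M$ be a loopless rank-$4$ matroid that is hypermodular but not modular, with closure operator $X\mapsto\overline{X}$. Let $F$ and $L$ be disjoint flats of $M$ of rank $3$ and $2$ respectively, and let $A_1,\dots,A_n$ be all the rank-$3$ flats of $M$ containing $L$. Put $T_i=A_i\cap F$ for $i\in[n]$, $T_0=L$, and $\mathcal{T}=\{T_0,\dots,T_n\}$. For a flat $J$, let $(J\vee\mathcal{T})^{(3)}=\{\overline{J\cup T}: T\in\mathcal{T},\ r(J\cup T)=3\}$. Let $\mathcal{J}$ be the collection of rank-$2$ flats $J\subseteq E(M)-(F\sqcup L)$ such that $|(J\vee\mathcal{T})^{(3)}|\ge2$, let $\mathcal{J}_+=\mathcal{J}\cup\mathcal{T}$, and let $\mathcal{J}^\sharp$ be the collection of rank-$3$ flats of $M$ containing some $T\in\mathcal{T}$. Then the following are equivalent: (1) $\mathcal{J}^\sharp\supseteq\{\overline{J\cup J'}: J,J'\in\mathcal{J}_+,\ J\neq J'\}$. (2) There is a rank-$4$ hypermodular matroid $\tilde M$ on $E(M)\cup\{\tilde m\}$ (with $\tilde m\notin E(M)$) such that $\tilde M|_{E(M)}=M$, the total sum of modular defects of $\tilde M$ is less than that of $M$, and the rank-$i$ flats $\mathcal{L}^{(i)}(\tilde M)$ of $\tilde M$ are: (a) $\mathcal{L}^{(4)}(\tilde M)=\{E(M)\cup\{\tilde m\}\}$ and $\mathcal{L}^{(0)}(\tilde M)=\{\emptyset\}$; (b) $\mathcal{L}^{(3)}(\tilde M)=(\mathcal{L}^{(3)}(M)-\mathcal{J}^\sharp)\cup\{J\cup\{\tilde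 m\}: J\in\mathcal{J}^\sharp\}$; (c) $\mathcal{L}^{(2)}(\tilde M)=(\mathcal{L}^{(2)}(M)-\mathcal{J}_+)\cup\{J\cup\{\tilde m\}: J\in\mathcal{J}_+\}$; (d) $\mathcal{L}^{(1)}(\tilde M)=\mathcal{L}^{(1)}(M)\cup\{\{\tilde m\}\}$.
   Context: All matroids are finite; $r$ denotes the rank function, $\mathcal{L}^{(i)}(M)$ the set of rank-$i$ flats of $M$, and $[n]=\{1,\dots,n\}$. A pair of flats $\{A,B\}$ is modular if $r(A\cup B)+r(A\cap B)=r(A)+r(B)$; its modular defect is $r(A)+r(B)-r(A\cup B)-r(A\cap B)\ge0$. The total sum of modular defects of a matroid is the sum of the modular defects over all pairs of its flats. A matroid is modular if every pair of flats is modular. A matroid of rank $k\ge3$ is hypermodular if every pair of two flats of rank $k-1$ is modular. *)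

theory Defs
  imports Complex_Main
begin

text \<open>A finite matroid is given by its ground set \<open>E\<close> and its independence predicate \<open>I\<close>.\<close>

locale matroid =
  fixes E :: "'a set" and I :: "'a set \<Rightarrow> bool"
  assumes finite_ground: "finite E"
    and indep_subset_ground: "I X \<Longrightarrow> X \<subseteq> E"
    and indep_empty: "I {}"
    and indep_mono: "I Y \<Longrightarrow> X \<subseteq> Y \<Longrightarrow> I X"
    and indep_augment: "I X \<Longrightarrow> I Y \<Longrightarrow> card X < card Y \<Longrightarrow> \<exists>y\<in>Y - X. I (insert y X)"

text \<open>\<open>mrank\<close> and everything built on it is only meant for subsets of the finite ground set.\<close>

definition mrank :: "('a set \<Rightarrow> bool) \<Rightarrow> 'a set \<Rightarrow> nat" where
  "mrank I X = Max {card Y | Y. Y \<subseteq> X \<and> I Y}"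

definition mclosure :: "'a set \<Rightarrow> ('a set \<Rightarrow> bool) \<Rightarrow> 'a set \<Rightarrow> 'a set" where
  "mclosure E I X = {x \<in> E. mrank I (insert x X) = mrank I X}"

definition flats :: "'a set \<Rightarrow> ('a set \<Rightarrow> bool) \<Rightarrow> 'a set set" where
  "flats E I = {A. A \<subseteq> E \<and> mclosure E I A = A}"

definition rank_flats :: "'a set \<Rightarrow> ('a set \<Rightarrow> bool) \<Rightarrow> nat \<Rightarrow> 'a set set" where
  "rank_flats E I i = {A \<in> flats E I. mrank I A = i}"

definition mrestrict :: "('a set \<Rightarrow> bool) \<Rightarrow> 'a set \<Rightarrow> 'a set \<Rightarrow> bool" where
  "mrestrict I X = (\<lambda>Y. Y \<subseteq> X \<and> I Y)"

definition loopless :: "'a set \<Rightarrow> ('a set \<Rightarrow> bool) \<Rightarrow> bool" where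
  "loopless E I \<longleftrightarrow> (\<forall>e\<in>E. mrank I {e} = 1)"

definition modular_pair :: "('a set \<Rightarrow> bool) \<Rightarrow> 'a set \<Rightarrow> 'a set \<Rightarrow> bool" where
  "modular_pair I A B \<longleftrightarrow> mrank I (A \<union> B) + mrank I (A \<inter> B) = mrank I A + mrank I B"

definition modular_defect :: "('a set \<Rightarrow> bool) \<Rightarrow> 'a set \<Rightarrow> 'a set \<Rightarrow> int" where
  "modular_defect I A B =
     int (mrank I A) + int (mrank I B) - int (mrank I (A \<union> B)) - int (mrank I (A \<inter> B))"

text \<open>
  The defect of a two-element set \<open>P = {A, B}\<close>, written symmetrically so that the total below can
  range over unordered pairs; see \<open>pair_defect_doubleton\<close>.  The formula is meant for
  \<open>A \<noteq> B\<close> only; a pair with \<open>A = B\<close> has modular defect 0 and is left out of the total.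
\<close>

definition pair_defect :: "('a set \<Rightarrow> bool) \<Rightarrow> 'a set set \<Rightarrow> int" where
  "pair_defect I P = (\<Sum>A\<in>P. int (mrank I A)) - int (mrank I (\<Union>P)) - int (mrank I (\<Inter>P))"

lemma pair_defect_doubleton: "A \<noteq> B \<Longrightarrow> pair_defect I {A, B} = modular_defect I A B"
  by (simp add: pair_defect_def modular_defect_def)

lemma modular_defect_same: "modular_defect I A A = 0"
  by (simp add: modular_defect_def)

definition total_modular_defect :: "'a set \<Rightarrow> ('a set \<Rightarrow> bool) \<Rightarrow> int" where
  "total_modular_defect E I = (\<Sum>P | P \<subseteq> flats E I \<and> card P = 2. pair_defect I P)"

definition modular_matroid :: "'a set \<Rightarrow> ('a set \<Rightarrow> bool) \<Rightarrow> bool" where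
  "modular_matroid E I \<longleftrightarrow> (\<forall>A\<in>flats E I. \<forall>B\<in>flats E I. modular_pair I A B)"

definition hypermodular :: "'a set \<Rightarrow> ('a set \<Rightarrow> bool) \<Rightarrow> bool" where
  "hypermodular E I \<longleftrightarrow> mrank I E \<ge> 3 \<and>
     (\<forall>A\<in>rank_flats E I (mrank I E - 1). \<forall>B\<in>rank_flats E I (mrank I E - 1). modular_pair I A B)"

text \<open>\<open>(J \<or> \<T>)\<^sup>3\<close>, the family of rank-3 flats spanned by \<open>J\<close> and a member of \<open>\<T>\<close>.\<close>

definition rank3_joins :: "'a set \<Rightarrow> ('a set \<Rightarrow> bool) \<Rightarrow> 'a set set \<Rightarrow> 'a set \<Rightarrow> 'a set set" where
  "rank3_joins E I \<T> J = {mclosure E I (J \<union> T) | T. T \<in> \<T> \<and> mrank I (J \<union> T) = 3}"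

definition new_lines ::
    "'a set \<Rightarrow> ('a set \<Rightarrow> bool) \<Rightarrow> 'a set \<Rightarrow> 'a set \<Rightarrow> 'a set set \<Rightarrow> 'a set set" where
  "new_lines E I F L \<T> =
     {J \<in> rank_flats E I 2. J \<subseteq> E - (F \<union> L) \<and> card (rank3_joins E I \<T> J) \<ge> 2}"

definition flats3_above :: "'a set \<Rightarrow> ('a set \<Rightarrow> bool) \<Rightarrow> 'a set set \<Rightarrow> 'a set set" where
  "flats3_above E I \<T> = {H \<in> rank_flats E I 3. \<exists>T\<in>\<T>. T \<subseteq> H}"

end

theory Submission
  imports Defs
begin

text \<open>
  The members of \<open>\<J>\<^sup>\<sharp>\<close> and \<open>\<J>\<^sub>+\<close>, together with \<open>E\<close>, are the flats to receive the new point.  They form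
  a modular cut exactly when any two lines of \<open>\<J>\<^sub>+\<close> span a plane of \<open>\<J>\<^sup>\<sharp>\<close>: two planes of
  \<open>\<J>\<^sup>\<sharp>\<close> always meet in a line of \<open>\<J>\<^sub>+\<close>, and coplanarity forces the lines of \<open>\<J>\<^sub>+\<close> to be pairwise
  disjoint and every plane above such a line to belong to \<open>\<J>\<^sup>\<sharp>\<close>.  Since every point lies on a
  line of \<open>\<J>\<^sub>+\<close> and every line in a plane of \<open>\<J>\<^sup>\<sharp>\<close>, the extension has no new flat besides \<open>{m}\<close>.
  Modular defects can only drop under this extension, and that of \<open>{F, L}\<close> does, because \<open>F\<close> and
  \<open>L\<close> now meet in \<open>m\<close>.  Conversely, in an extension as in (2) two lines of \<open>\<J>\<^sub>+\<close> acquire the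
  common point \<open>m\<close>, so they are coplanar.
\<close>

section \<open>Rank, closure and flats of a finite matroid\<close>

context matroid
begin

abbreviation rk :: "'a set \<Rightarrow> nat" where "rk \<equiv> mrank I"

abbreviation cl :: "'a set \<Rightarrow> 'a set" where "cl \<equiv> mclosure E I"

lemma finite_indep_cards: "finite {card Y | Y. Y \<subseteq> X \<and> I Y}"
  by (rule finite_subset[of _ "card ` Pow E"]) (use finite_ground indep_subset_ground in auto)

lemma finite_indep: "I X \<Longrightarrow> finite X"
  using finite_ground indep_subset_ground finite_subset by blast

lemma card_le_rank: "I Y \<Longrightarrow> Y \<subseteq> X \<Longrightarrow> card Y \<le> rk X"
  unfolding mrank_def by (rule Max_ge[OF finite_indep_cards]) auto

lemma basis_exists: "\<exists>B\<subseteq>X. I B \<and> card B = rk X"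
proof -
  have "rk X \<in> {card Y | Y. Y \<subseteq> X \<and> I Y}"
    unfolding mrank_def by (rule Max_in[OF finite_indep_cards]) (use indep_empty in auto)
  then show ?thesis by auto
qed

lemma rank_mono: "X \<subseteq> Y \<Longrightarrow> rk X \<le> rk Y"
  by (metis basis_exists card_le_rank subset_trans)

lemma rank_indep: "I X \<Longrightarrow> rk X = card X"
  by (metis basis_exists card_le_rank card_mono finite_indep le_antisym order_refl)

lemma rank_empty [simp]: "rk {} = 0"
  using rank_indep[OF indep_empty] by simp

lemma basis_extends:
  assumes "I Y" "Y \<subseteq> X"
  shows "\<exists>B. Y \<subseteq> B \<and> B \<subseteq> X \<and> I B \<and> card B = rk X"
  using assms
proof (induction "rk X - card Y" arbitrary: Y rule: less_induct)
  case less
  show ?case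
  proof (cases "card Y = rk X")
    case True
    then show ?thesis using less.prems by blast
  next
    case False
    then have lt: "card Y < rk X" using card_le_rank less.prems le_neq_implies_less by blast
    obtain B where B: "B \<subseteq> X" "I B" "card B = rk X" using basis_exists by blast
    then obtain y where y: "y \<in> B - Y" "I (insert y Y)"
      using indep_augment[of Y B] less.prems lt by auto
    have "card (insert y Y) = Suc (card Y)" using y finite_indep less.prems by simp
    then have "rk X - card (insert y Y) < rk X - card Y" using lt by simp
    moreover have "insert y Y \<subseteq> X" using y B less.prems by auto
    ultimately obtain B' where "insert y Y \<subseteq> B'" "B' \<subseteq> X" "I B'" "card B' = rk X"
      using less.hyps y(2) by meson
    then show ?thesis by blast
  qed
qed

text \<open>Extend a basis \<open>C\<close> of \<open>A \<inter> B\<close> to a basis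
  \<open>D\<close> of \<open>A \<union> B\<close>. The independent sets \<open>D \<inter> A\<close>
  and \<open>D \<inter> B\<close> cover \<open>D\<close>, and their overlap contains
  \<open>C\<close>, so their sizes add up to at least the left-hand side.\<close>

lemma rank_submodular: "rk (A \<union> B) + rk (A \<inter> B) \<le> rk A + rk B"
proof -
  obtain C where C: "C \<subseteq> A \<inter> B" "I C" "card C = rk (A \<inter> B)" using basis_exists by blast
  then obtain D where D: "C \<subseteq> D" "D \<subseteq> A \<union> B" "I D" "card D = rk (A \<union> B)"
    using basis_extends[of C "A \<union> B"] by blast
  have fin: "finite D" using D finite_indep by blast
  have "card (D \<inter> A) + card (D \<inter> B) = card D + card (D \<inter> A \<inter> (D \<inter> B))"
    using card_Un_Int[of "D \<inter> A" "D \<inter> B"] fin D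
    by (simp add: Int_Un_distrib[symmetric] Int_absorb2)
  moreover have "card C \<le> card (D \<inter> A \<inter> (D \<inter> B))"
    by (rule card_mono) (use fin C D in auto)
  moreover have "card (D \<inter> A) \<le> rk A" "card (D \<inter> B) \<le> rk B"
    using D indep_mono by (auto intro!: card_le_rank)
  ultimately show ?thesis using C D by linarith
qed

lemma rank_insert_le: "rk (insert x X) \<le> rk X + 1"
proof -
  obtain B where B: "B \<subseteq> insert x X" "I B" "card B = rk (insert x X)" using basis_exists by blast
  have "card (B - {x}) \<le> rk X" by (rule card_le_rank) (use B indep_mono in auto)
  moreover have "card B \<le> card (B - {x}) + 1"
    using card_Suc_Diff1[OF finite_indep[OF B(2)], of x] by (cases "x \<in> B") auto
  ultimately show ?thesis using B by linarith
qed

lemma rank_insert_ge: "rk X \<le> rk (insert x X)"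
  by (rule rank_mono) auto

lemma rank_insert_indep:
  assumes "I X" "x \<notin> X"
  shows "I (insert x X) \<longleftrightarrow> rk (insert x X) = rk X + 1"
proof
  assume "I (insert x X)"
  then show "rk (insert x X) = rk X + 1" using assms rank_indep finite_indep by simp
next
  assume r: "rk (insert x X) = rk X + 1"
  obtain B where B: "B \<subseteq> insert x X" "I B" "card B = rk (insert x X)" using basis_exists by blast
  have "finite (insert x X)" "card (insert x X) = card B"
    using assms B r rank_indep finite_indep by auto
  then have "B = insert x X" using B card_subset_eq by metis
  then show "I (insert x X)" using B by simp
qed

lemma closure_subset_ground: "cl X \<subseteq> E"
  by (auto simp: mclosure_def)

lemma subset_closure: "X \<subseteq> E \<Longrightarrow> X \<subseteq> cl X"
  by (auto simp: mclosure_def insert_absorb)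

lemma closure_mono:
  assumes "X \<subseteq> Y"
  shows "cl X \<subseteq> cl Y"
proof
  fix x assume x: "x \<in> cl X"
  have "rk (insert x X \<union> Y) + rk (insert x X \<inter> Y) \<le> rk (insert x X) + rk Y"
    by (rule rank_submodular)
  moreover have "rk X \<le> rk (insert x X \<inter> Y)" using assms by (auto intro: rank_mono)
  moreover have "insert x X \<union> Y = insert x Y" using assms by auto
  ultimately have "rk (insert x Y) \<le> rk Y" using x by (simp add: mclosure_def)
  then show "x \<in> cl Y" using x rank_insert_ge[of Y x] by (auto simp: mclosure_def)
qed

lemma subset_closureI:
  assumes "X \<subseteq> Y" "Y \<subseteq> E" "rk Y \<le> rk X"
  shows "Y \<subseteq> cl X"
proof
  fix y assume "y \<in> Y"
  then have "rk (insert y X) \<le> rk Y" using assms by (auto intro: rank_mono)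
  then show "y \<in> cl X"
    using \<open>y \<in> Y\<close> assms rank_insert_ge[of X y] by (auto simp: mclosure_def)
qed

text \<open>Extend a basis \<open>B\<close> of \<open>X\<close> to one of the union. A further
  element \<open>y\<close> would give an independent set \<open>insert y B\<close> inside
  \<open>insert y X\<close>, whose rank is still only \<open>rk X\<close>.\<close>

lemma rank_union_closure: "rk (X \<union> cl X) = rk X"
proof -
  obtain B where B: "B \<subseteq> X" "I B" "card B = rk X" using basis_exists by blast
  then obtain D where D: "B \<subseteq> D" "D \<subseteq> X \<union> cl X" "I D" "card D = rk (X \<union> cl X)"
    using basis_extends[of B "X \<union> cl X"] by blast
  have "D \<subseteq> B"
  proof (rule ccontr)
    assume "\<not> D \<subseteq> B"
    then obtain y where y: "y \<in> D" "y \<notin> B" by blast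
    have "I (insert y B)" using D y indep_mono[of D "insert y B"] by auto
    then have "card (insert y B) \<le> rk (insert y X)"
      using card_le_rank[of "insert y B" "insert y X"] B by auto
    moreover have "rk (insert y X) = rk X"
      using D y by (auto simp: mclosure_def insert_absorb)
    ultimately show False using B y finite_indep by simp
  qed
  then show ?thesis using B D by (metis subset_antisym)
qed

lemma rank_closure: "X \<subseteq> E \<Longrightarrow> rk (cl X) = rk X"
  using rank_union_closure[of X] subset_closure[of X] by (simp add: Un_absorb1)

lemma closure_in_flats: "X \<subseteq> E \<Longrightarrow> cl X \<in> flats E I"
  using subset_closureI[of X "cl (cl X)"] subset_closure[of X] subset_closure[of "cl X"]
    rank_closure[of X] rank_closure[of "cl X"] closure_subset_ground
  by (auto simp: flats_def)

lemma flatD: "A \<in> flats E I \<Longrightarrow> A \<subseteq> E" "A \<in> flats E I \<Longrightarrow> cl A = A"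
  by (auto simp: flats_def)

lemma closure_subset_flat: "A \<in> flats E I \<Longrightarrow> X \<subseteq> A \<Longrightarrow> cl X \<subseteq> A"
  using closure_mono flatD by metis

lemma flat_insert_rank: "A \<in> flats E I \<Longrightarrow> x \<in> E \<Longrightarrow> x \<notin> A \<Longrightarrow> rk (insert x A) = rk A + 1"
  using rank_insert_le[of x A] rank_insert_ge[of A x] flatD(2)[of A]
  by (fastforce simp: mclosure_def)

lemma flatI:
  assumes "A \<subseteq> E" "\<And>x. x \<in> E - A \<Longrightarrow> rk (insert x A) \<noteq> rk A"
  shows "A \<in> flats E I"
  using assms subset_closure[of A] by (auto simp: flats_def mclosure_def)

lemma subset_flatI:
  assumes "A \<in> flats E I" "X \<subseteq> A" "X \<subseteq> Y" "Y \<subseteq> E" "rk Y \<le> rk X"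
  shows "Y \<subseteq> A"
  using assms subset_closureI closure_subset_flat by (meson subset_trans)

text \<open>The rank bounds make \<open>X\<close> span both flats, so each of them is the closure of
  \<open>X\<close>.\<close>

lemma flat_eqI:
  assumes "A \<in> flats E I" "B \<in> flats E I" "X \<subseteq> A" "X \<subseteq> B" "rk A \<le> rk X" "rk B \<le> rk X"
  shows "A = B"
  using assms subset_flatI flatD by (meson subset_antisym)

lemma closure_eqI:
  assumes "X \<subseteq> Y" "Y \<subseteq> E" "rk Y \<le> rk X"
  shows "cl X = cl Y"
  using assms subset_closure[of Y] closure_mono[of X Y] subset_closureI[of X Y]
    closure_subset_flat[OF closure_in_flats[of X], of Y] by auto

lemma flat_Int:
  assumes "A \<in> flats E I" "B \<in> flats E I"
  shows "A \<inter> B \<in> flats E I"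
  using assms closure_subset_flat[of A "A \<inter> B"] closure_subset_flat[of B "A \<inter> B"]
    subset_closure[of "A \<inter> B"] flatD(1)[of A]
  by (auto simp: flats_def)

lemma ground_flat: "E \<in> flats E I"
  using closure_subset_ground subset_closure by (auto simp: flats_def)

lemma rank_flatsD:
  assumes "A \<in> rank_flats E I i"
  shows "A \<in> flats E I" "A \<subseteq> E" "rk A = i"
  using assms flatD by (auto simp: rank_flats_def)

lemma rank_flats_closure: "X \<subseteq> E \<Longrightarrow> cl X \<in> rank_flats E I (rk X)"
  by (simp add: rank_flats_def closure_in_flats rank_closure)

lemma finite_flats: "finite (flats E I)"
  by (rule finite_subset[of _ "Pow E"]) (auto simp: flats_def finite_ground)

end

lemma mrank_mrestrict:
  assumes "X \<subseteq> E"
  shows "mrank (mrestrict I E) X = mrank I X"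
proof -
  have "{card Y | Y. Y \<subseteq> X \<and> mrestrict I E Y} = {card Y | Y. Y \<subseteq> X \<and> I Y}"
    using assms by (auto simp: mrestrict_def)
  then show ?thesis by (simp add: mrank_def)
qed

section \<open>Single-element extensions\<close>

text \<open>Crapo's construction: over an independent set the new point is dependent exactly when
  that set spans a member of the cut.\<close>

definition extension_indep ::
    "'a set \<Rightarrow> ('a set \<Rightarrow> bool) \<Rightarrow> 'a set set \<Rightarrow> 'a \<Rightarrow> 'a set \<Rightarrow> bool" where
  "extension_indep E I C m X \<longleftrightarrow>
     X \<subseteq> insert m E \<and> I (X - {m}) \<and> (m \<in> X \<longrightarrow> mclosure E I (X - {m}) \<notin> C)"

text \<open>
  Closure under intersection is only required for modular pairs covering their intersection;
  together with upward closure this already implies it for all modular pairs.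
\<close>

locale modular_cut = matroid +
  fixes C :: "'a set set" and m :: 'a
  assumes cut_flats: "C \<subseteq> flats E I"
    and cut_up: "A \<in> C \<Longrightarrow> B \<in> flats E I \<Longrightarrow> A \<subseteq> B \<Longrightarrow> B \<in> C"
    and cut_Int: "A \<in> C \<Longrightarrow> B \<in> C \<Longrightarrow> mrank I A = mrank I B \<Longrightarrow>
      mrank I (A \<union> B) = mrank I A + 1 \<Longrightarrow> mrank I (A \<inter> B) + 1 = mrank I A \<Longrightarrow> A \<inter> B \<in> C"
    and new_element: "m \<notin> E"
begin

abbreviation Iext :: "'a set \<Rightarrow> bool" where "Iext \<equiv> extension_indep E I C m"

lemma Iext_ground: "X \<subseteq> E \<Longrightarrow> Iext X \<longleftrightarrow> I X"
proof -
  assume "X \<subseteq> E"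
  then have "m \<notin> X" "X - {m} = X" using new_element by auto
  then show ?thesis using \<open>X \<subseteq> E\<close> by (auto simp: extension_indep_def)
qed

lemma Iext_indep: "I X \<Longrightarrow> Iext X"
  using Iext_ground indep_subset_ground by blast

lemma Iext_insert: "X \<subseteq> E \<Longrightarrow> Iext (insert m X) \<longleftrightarrow> I X \<and> cl X \<notin> C"
proof -
  assume "X \<subseteq> E"
  then have "insert m X - {m} = X" using new_element by auto
  then show ?thesis using \<open>X \<subseteq> E\<close> by (auto simp: extension_indep_def)
qed

lemma Iext_cases:
  assumes "Iext X"
  obtains "I X" "m \<notin> X" | X0 where "X = insert m X0" "I X0" "cl X0 \<notin> C" "m \<notin> X0"
proof (cases "m \<in> X")
  case True
  then show ?thesis using assms that(2)[of "X - {m}"] by (auto simp: extension_indep_def insert_absorb)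
next
  case False
  then show ?thesis using assms that(1) by (auto simp: extension_indep_def)
qed

text \<open>
  If \<open>X\<close> spans no member of the cut, the members spanned by \<open>X\<close> and one more element are all
  equal: two different ones would intersect in the closure of \<open>X\<close>.
\<close>

lemma cut_cover_unique:
  assumes X: "X \<subseteq> E" "cl X \<notin> C"
    and y: "y \<in> E" "cl (insert y X) \<in> C" and z: "z \<in> E" "cl (insert z X) \<in> C"
  shows "cl (insert y X) = cl (insert z X)"
proof (rule ccontr)
  let ?Y = "cl (insert y X)" and ?Z = "cl (insert z X)"
  assume ne: "?Y \<noteq> ?Z"
  have sub: "insert y X \<subseteq> E" "insert z X \<subseteq> E" using assms by auto
  \<comment> \<open>If the rank did not grow, \<open>w\<close> would lie in \<open>cl X\<close>, and
    upward closure would put \<open>cl X\<close> itself into the cut.\<close>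
  have rank: "rk (cl (insert w X)) = rk X + 1" if "w \<in> E" "cl (insert w X) \<in> C" for w
  proof (rule ccontr)
    assume "rk (cl (insert w X)) \<noteq> rk X + 1"
    then have "rk (insert w X) = rk X"
      using rank_closure[of "insert w X"] X that rank_insert_le[of w X]
        rank_insert_ge[of X w] by auto
    then have "insert w X \<subseteq> cl X" using X that subset_closure by (auto simp: mclosure_def)
    then have "cl (insert w X) \<subseteq> cl X" by (rule closure_subset_flat[OF closure_in_flats[OF X(1)]])
    then have "cl X \<in> C" using cut_up[OF that(2) closure_in_flats[OF X(1)]] by blast
    then show False using X by simp
  qed
  note rY = rank[OF y] and rZ = rank[OF z]
  have fY: "?Y \<in> flats E I" and fZ: "?Z \<in> flats E I" using sub closure_in_flats by blast+
  have XYZ: "X \<subseteq> ?Y \<inter> ?Z" using subset_closure sub by blast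
  have "rk (?Y \<union> ?Z) \<noteq> rk X + 1"
  proof
    assume "rk (?Y \<union> ?Z) = rk X + 1"
    then have "?Y \<union> ?Z \<subseteq> ?Y" "?Y \<union> ?Z \<subseteq> ?Z"
      using subset_flatI[OF fY subset_refl, of "?Y \<union> ?Z"] subset_flatI[OF fZ subset_refl, of "?Y \<union> ?Z"]
        rY rZ closure_subset_ground by auto
    then show False using ne by blast
  qed
  moreover have "rk ?Y \<le> rk (?Y \<union> ?Z)" "rk X \<le> rk (?Y \<inter> ?Z)" using XYZ by (auto intro: rank_mono)
  ultimately have r: "rk (?Y \<union> ?Z) = rk X + 2" "rk (?Y \<inter> ?Z) = rk X"
    using rank_submodular[of ?Y ?Z] rY rZ by linarith+
  then have "?Y \<inter> ?Z \<in> C" using cut_Int[OF y(2) z(2)] rY rZ by simp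
  moreover have "?Y \<inter> ?Z = cl X"
    by (rule flat_eqI[of _ _ X])
      (use XYZ X r fY fZ flat_Int closure_in_flats subset_closure rank_closure in auto)
  ultimately show False using X by simp
qed

text \<open>Augmentation in the old matroid settles the case where \<open>m\<close> is in neither
  set. Otherwise the danger is that an added element makes the old part span a member of the cut; a
  failed augmentation is turned into the statement that the old part of \<open>Y\<close> spans such
  a member although \<open>m\<close> is in \<open>Y\<close>.\<close>

lemma Iext_augment:
  assumes "Iext X" "Iext Y" "card X < card Y"
  shows "\<exists>y\<in>Y - X. Iext (insert y X)"
  using assms(1)
proof (cases rule: Iext_cases)
  case 1
  note X = this
  show ?thesis using assms(2)
  proof (cases rule: Iext_cases)
    case 1
    then show ?thesis using indep_augment[of X Y] X assms(3) Iext_indep by blast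
  next
    case (2 Y0)
    have XE: "X \<subseteq> E" "Y0 \<subseteq> E" using X 2 indep_subset_ground by auto
    have le: "card X \<le> card Y0" using assms(3) 2 finite_indep by auto
    show ?thesis
    proof (cases "cl X \<in> C")
      case False
      then show ?thesis using X 2 XE Iext_insert by auto
    next
      case True
      \<comment> \<open>Here \<open>m\<close> cannot be added to \<open>X\<close>, so an old element
        must do. If none did, \<open>Y0\<close> would lie in \<open>cl X\<close> and, being at least
        as large as \<open>X\<close>, would span it; then \<open>cl Y0\<close> would be in the cut,
        against the independence of \<open>insert m Y0\<close>.\<close>
      have "\<exists>y\<in>Y0 - X. I (insert y X)"
      proof (rule ccontr)
        assume no: "\<not> ?thesis"
        have "Y0 \<subseteq> cl X"
        proof
          fix y assume y: "y \<in> Y0"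
          show "y \<in> cl X"
          proof (cases "y \<in> X")
            case True
            then show ?thesis using subset_closure XE by blast
          next
            case False
            then have "rk (insert y X) \<noteq> rk X + 1" using no y rank_insert_indep X by blast
            then show ?thesis using rank_insert_le[of y X] rank_insert_ge[of X y] y XE
              by (auto simp: mclosure_def)
          qed
        qed
        then have "cl X \<subseteq> cl Y0"
          using subset_closureI[of Y0 "cl X"] le rank_indep X 2 rank_closure[OF XE(1)]
            closure_subset_ground by simp
        then show False using cut_up[OF True] closure_in_flats XE 2 by blast
      qed
      then show ?thesis using 2 Iext_indep by blast
    qed
  qed
next
  case (2 X0)
  note X = this
  have XE: "X0 \<subseteq> E" using X indep_subset_ground by auto
  define Y0 where "Y0 = Y - {m}"
  have Y0: "I Y0" using assms(2) by (simp add: extension_indep_def Y0_def)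
  then have YE: "Y0 \<subseteq> E" using indep_subset_ground by auto
  have cX: "card X = card X0 + 1" using X finite_indep by simp
  have cY: "card Y = (if m \<in> Y then card Y0 + 1 else card Y0)"
    using finite_indep[OF Y0] card_Suc_Diff1[of Y m] unfolding Y0_def by auto
  have lt: "card X0 < card Y0" using assms(3) cX cY by (auto split: if_splits)
  show ?thesis
  proof (rule ccontr)
    assume no: "\<not> ?thesis"
    \<comment> \<open>Since augmenting \<open>X\<close> fails, the only obstruction left for an old
      element independent over \<open>X0\<close> is the cut.\<close>
    have cut: "cl (insert y X0) \<in> C" if "y \<in> Y0 - X0" "I (insert y X0)" for y
    proof -
      have "insert y X = insert m (insert y X0)" using X by auto
      moreover have "y \<in> Y - X" using that X Y0_def by auto
      ultimately show ?thesis
        using no that Iext_insert[of "insert y X0"] indep_subset_ground[of "insert y X0"] by metis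
    qed
    obtain w where w: "w \<in> Y0 - X0" "I (insert w X0)"
      using indep_augment[OF X(2) Y0 lt] by blast
    \<comment> \<open>By \<open>cut_cover_unique\<close> all these members of the cut coincide with
      \<open>Z\<close>, which therefore contains \<open>Y0\<close>. As \<open>Y0\<close> is larger
      than \<open>X0\<close>, it spans \<open>Z\<close>; counting then forces \<open>m\<close> into
      \<open>Y\<close>.\<close>
    define Z where "Z = cl (insert w X0)"
    have wE: "insert w X0 \<subseteq> E" using w YE XE by auto
    have ZC: "Z \<in> C" using cut w Z_def by blast
    have rZ: "rk Z = card X0 + 1"
      using rank_closure[OF wE] rank_indep w finite_indep X Z_def by simp
    have XZ: "cl X0 \<subseteq> Z" unfolding Z_def by (rule closure_mono) auto
    have "Y0 \<subseteq> Z"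
    proof
      fix y assume y: "y \<in> Y0"
      show "y \<in> Z"
      proof (cases "y \<in> cl X0")
        case True
        then show ?thesis using XZ by blast
      next
        case False
        then have y': "y \<in> Y0 - X0" using subset_closure XE y by blast
        have "rk (insert y X0) = rk X0 + 1"
          using False y YE rank_insert_le[of y X0] rank_insert_ge[of X0 y]
          by (fastforce simp: mclosure_def)
        then have "I (insert y X0)" using rank_insert_indep X y' by blast
        then have "cl (insert y X0) \<in> C" using cut y' by blast
        then have "cl (insert y X0) = Z"
          unfolding Z_def using cut_cover_unique[OF XE X(3)] ZC Z_def y w YE by blast
        moreover have "y \<in> cl (insert y X0)" using subset_closure[of "insert y X0"] y YE XE by blast
        ultimately show ?thesis by simp
      qed
    qed
    moreover have "rk Z \<le> rk Y0" using rZ lt rank_indep[OF Y0] by simp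
    ultimately have "Z \<subseteq> cl Y0" "rk Z = rk Y0"
      using subset_closureI[of Y0 Z] rank_mono[of Y0 Z] closure_subset_ground Z_def by auto
    then have "cl Y0 \<in> C" "card Y0 = card X0 + 1"
      using cut_up[OF ZC] closure_in_flats YE rZ rank_indep[OF Y0] by auto
    moreover have "m \<in> Y" using \<open>card Y0 = card X0 + 1\<close> assms(3) cX cY by (auto split: if_splits)
    ultimately show False using assms(2) by (simp add: extension_indep_def Y0_def)
  qed
qed

lemma matroid_extension: "matroid (insert m E) Iext"
proof
  fix X Y assume Y: "Iext Y" "X \<subseteq> Y"
  have "I (X - {m})" using Y indep_mono[of "Y - {m}" "X - {m}"] by (auto simp: extension_indep_def)
  \<comment> \<open>Upward closure of the cut passes membership from the smaller span to the larger
    one.\<close>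
  moreover have "cl (X - {m}) \<notin> C" if "m \<in> X"
  proof
    assume "cl (X - {m}) \<in> C"
    moreover have "cl (X - {m}) \<subseteq> cl (Y - {m})" by (rule closure_mono) (use Y in auto)
    moreover have "Y - {m} \<subseteq> E" using Y by (auto simp: extension_indep_def)
    ultimately have "cl (Y - {m}) \<in> C" using cut_up closure_in_flats by blast
    then show False using Y that by (auto simp: extension_indep_def)
  qed
  ultimately show "Iext X" using Y by (auto simp: extension_indep_def)
qed (use finite_ground indep_empty Iext_augment in \<open>auto simp: extension_indep_def\<close>)

sublocale ext: matroid "insert m E" Iext
  by (rule matroid_extension)

lemma mrestrict_Iext: "mrestrict Iext E = I"
  using Iext_ground indep_subset_ground by (auto simp: mrestrict_def fun_eq_iff)

lemma rank_ext_ground: "X \<subseteq> E \<Longrightarrow> ext.rk X = rk X"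
  using mrank_mrestrict[of X E Iext] by (simp add: mrestrict_Iext)

text \<open>A basis of \<open>X\<close> has the same closure as \<open>X\<close>, so
  \<open>m\<close> extends it unless \<open>cl X\<close> is in the cut. In that case an independent
  set of size \<open>rk X + 1\<close> would have to contain \<open>m\<close>, and its old part would
  already span \<open>X\<close>.\<close>

lemma rank_ext_insert:
  assumes "X \<subseteq> E"
  shows "ext.rk (insert m X) = (if cl X \<in> C then rk X else rk X + 1)"
proof -
  obtain B where B: "B \<subseteq> X" "I B" "card B = rk X" using basis_exists by blast
  have BE: "B \<subseteq> E" using B assms by blast
  have clB: "cl B = cl X" using closure_eqI B assms rank_indep by simp
  have mB: "m \<notin> B" using BE new_element by blast
  have bounds: "rk X \<le> ext.rk (insert m X)" "ext.rk (insert m X) \<le> rk X + 1"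
    using ext.rank_insert_ge[of X m] ext.rank_insert_le[of m X] rank_ext_ground[OF assms] by auto
  show ?thesis
  proof (cases "cl X \<in> C")
    case False
    then have "Iext (insert m B)" using Iext_insert BE clB B by simp
    then have "card (insert m B) \<le> ext.rk (insert m X)" using ext.card_le_rank B by blast
    then show ?thesis using False bounds B mB finite_indep by simp
  next
    case True
    have "ext.rk (insert m X) \<noteq> rk X + 1"
    proof
      assume r: "ext.rk (insert m X) = rk X + 1"
      obtain D where D: "D \<subseteq> insert m X" "Iext D" "card D = rk X + 1"
        using ext.basis_exists[of "insert m X"] r by auto
      show False using D(2)
      proof (cases rule: Iext_cases)
        case 1
        then have "card D \<le> rk X" using D by (intro card_le_rank) auto
        then show False using D by simp
      next
        case (2 D0)
        then have "D0 \<subseteq> X" using D by auto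
        moreover have "card D0 = rk X" using D 2 finite_indep by simp
        ultimately have "cl D0 = cl X"
          using 2 assms closure_eqI rank_indep by simp
        then show False using True 2 by simp
      qed
    qed
    then show ?thesis using True bounds by simp
  qed
qed

lemma flats_ext_ground:
  assumes "X \<subseteq> E"
  shows "X \<in> flats (insert m E) Iext \<longleftrightarrow> X \<in> flats E I \<and> X \<notin> C"
proof
  assume X: "X \<in> flats (insert m E) Iext"
  have mX: "m \<notin> X" using assms new_element by blast
  have "X \<in> flats E I"
  proof (rule flatI[OF assms])
    fix x assume x: "x \<in> E - X"
    then have "ext.rk (insert x X) = ext.rk X + 1" using ext.flat_insert_rank[OF X] by auto
    then show "rk (insert x X) \<noteq> rk X" using x assms rank_ext_ground by simp
  qed
  moreover have "ext.rk (insert m X) = ext.rk X + 1" using ext.flat_insert_rank[OF X] mX by auto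
  ultimately show "X \<in> flats E I \<and> X \<notin> C"
    using rank_ext_insert[OF assms] rank_ext_ground[OF assms] flatD(2) by (auto split: if_splits)
next
  assume X: "X \<in> flats E I \<and> X \<notin> C"
  show "X \<in> flats (insert m E) Iext"
  proof (rule ext.flatI)
    fix x assume x: "x \<in> insert m E - X"
    show "ext.rk (insert x X) \<noteq> ext.rk X"
    proof (cases "x = m")
      case True
      then show ?thesis using rank_ext_insert rank_ext_ground assms X flatD(2) by simp
    next
      case False
      then show ?thesis using rank_ext_ground assms X x flat_insert_rank[of X x] by simp
    qed
  qed (use assms in auto)
qed

text \<open>For \<open>X\<close> outside the cut, \<open>m\<close> raises the rank by one. If some
  \<open>insert x X\<close> spans a member of the cut, adding \<open>x\<close> after
  \<open>m\<close> gains nothing, so \<open>x\<close> belongs to the closure of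
  \<open>insert m X\<close>. The second alternative thus describes the flats with no cover in the
  cut.\<close>

lemma flats_ext_insert:
  assumes "X \<subseteq> E"
  shows "insert m X \<in> flats (insert m E) Iext \<longleftrightarrow>
    X \<in> flats E I \<and> (X \<in> C \<or> (\<forall>x\<in>E - X. cl (insert x X) \<notin> C))"
proof -
  have cut_insert: "cl (insert x X) \<in> C" if "cl X \<in> C" "x \<in> E" for x
    using cut_up[OF that(1)] closure_in_flats[of "insert x X"] closure_mono[of X "insert x X"]
      that assms by auto
  have rX: "rk X \<le> rk (insert x X)" "rk (insert x X) \<le> rk X + 1" for x
    using rank_insert_le rank_insert_ge by auto
  have swap: "insert x (insert m X) = insert m (insert x X)" for x by auto
  show ?thesis
  proof
    assume X: "insert m X \<in> flats (insert m E) Iext"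
    have step: "ext.rk (insert m (insert x X)) = ext.rk (insert m X) + 1" if "x \<in> E - X" for x
      using ext.flat_insert_rank[OF X, of x] that new_element by (auto simp: swap)
    have flat: "X \<in> flats E I"
    proof (rule flatI[OF assms])
      fix x assume x: "x \<in> E - X"
      show "rk (insert x X) \<noteq> rk X"
      proof
        assume r: "rk (insert x X) = rk X"
        have "cl (insert x X) = cl X"
          by (rule closure_eqI[symmetric]) (use x r assms in auto)
        then show False using step[OF x] r rank_ext_insert x assms by (simp split: if_splits)
      qed
    qed
    moreover have "X \<in> C \<or> (\<forall>x\<in>E - X. cl (insert x X) \<notin> C)"
    proof (rule ccontr)
      assume "\<not> ?thesis"
      then obtain x where x: "X \<notin> C" "x \<in> E - X" "cl (insert x X) \<in> C" by blast
      then show False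
        using step[OF x(2)] rank_ext_insert[of X] rank_ext_insert[of "insert x X"] assms
          flatD(2)[OF flat] rX[of x] by auto
    qed
    ultimately show "X \<in> flats E I \<and> (X \<in> C \<or> (\<forall>x\<in>E - X. cl (insert x X) \<notin> C))" by blast
  next
    assume X: "X \<in> flats E I \<and> (X \<in> C \<or> (\<forall>x\<in>E - X. cl (insert x X) \<notin> C))"
    show "insert m X \<in> flats (insert m E) Iext"
    proof (rule ext.flatI)
      fix x assume "x \<in> insert m E - insert m X"
      then have x: "x \<in> E - X" by auto
      have "rk (insert x X) = rk X + 1" using flat_insert_rank X x by auto
      then show "ext.rk (insert x (insert m X)) \<noteq> ext.rk (insert m X)"
        unfolding swap using rank_ext_insert[of X] rank_ext_insert[of "insert x X"] assms x X
          cut_insert[of x] flatD(2)[of X] by auto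
    qed (use assms in auto)
  qed
qed

section \<open>Lifting flats to the extension\<close>

lemma rank_ext_cut: "A \<in> C \<Longrightarrow> ext.rk (insert m A) = rk A"
  using rank_ext_insert[of A] cut_flats flatD by auto

text \<open>For a flat, this is its closure in the extension.\<close>

definition lift :: "'a set \<Rightarrow> 'a set" where
  "lift A = (if A \<in> C then insert m A else A)"

lemma lift_minus: "A \<subseteq> E \<Longrightarrow> lift A - {m} = A"
  using new_element by (auto simp: lift_def)

lemma inj_on_lift: "inj_on lift (flats E I)"
  using lift_minus flatD(1) by (metis inj_onI)

lemma rank_lift: "A \<in> flats E I \<Longrightarrow> ext.rk (lift A) = rk A"
  using rank_ext_cut rank_ext_ground flatD by (simp add: lift_def)

lemma lift_flat: "A \<in> flats E I \<Longrightarrow> lift A \<in> flats (insert m E) Iext"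
  using flats_ext_ground flats_ext_insert flatD(1) by (simp add: lift_def)

text \<open>If \<open>m\<close> is in one of the lifts, the flat spanned by
  \<open>A \<union> B\<close> lies in the cut by upward closure, so \<open>m\<close> adds no
  rank.\<close>

lemma rank_lift_Un:
  assumes "A \<in> flats E I" "B \<in> flats E I"
  shows "ext.rk (lift A \<union> lift B) = rk (A \<union> B)"
proof -
  have sub: "A \<union> B \<subseteq> E" using assms flatD by blast
  show ?thesis
  proof (cases "A \<in> C \<or> B \<in> C")
    case True
    then have "lift A \<union> lift B = insert m (A \<union> B)" by (auto simp: lift_def)
    moreover have "cl (A \<union> B) \<in> C"
      using True cut_up closure_in_flats[OF sub] subset_closure[OF sub] by blast
    ultimately show ?thesis using rank_ext_insert[OF sub] by simp
  next
    case False
    then show ?thesis using rank_ext_ground[OF sub] by (simp add: lift_def)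
  qed
qed

text \<open>The intersection may gain \<open>m\<close>. With the equality for unions, this is why
  modular defects can only drop.\<close>

lemma rank_lift_Int:
  assumes "A \<in> flats E I" "B \<in> flats E I"
  shows "rk (A \<inter> B) \<le> ext.rk (lift A \<inter> lift B)"
proof -
  have "A \<inter> B \<subseteq> E" using assms flatD by blast
  then have "rk (A \<inter> B) = ext.rk (A \<inter> B)" using rank_ext_ground by simp
  also have "\<dots> \<le> ext.rk (lift A \<inter> lift B)"
    by (rule ext.rank_mono) (auto simp: lift_def)
  finally show ?thesis .
qed

end

section \<open>A disjoint plane and line in a hypermodular matroid of rank 4\<close>

locale disjoint_plane_line = matroid +
  fixes F L :: "'a set"
  assumes loopless: "loopless E I"
    and rank_ground: "mrank I E = 4"
    and hypermodular: "hypermodular E I"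
    and plane_F: "F \<in> rank_flats E I 3"
    and line_L: "L \<in> rank_flats E I 2"
    and disjoint: "F \<inter> L = {}"
begin

abbreviation planes :: "'a set set" where "planes \<equiv> rank_flats E I 3"

abbreviation lines :: "'a set set" where "lines \<equiv> rank_flats E I 2"

text \<open>The family \<open>\<T>\<close> of the theorem freed from the enumeration of the planes
  above \<open>L\<close>. Built on it, \<open>cut_lines\<close> and \<open>cut_planes\<close> are
  \<open>\<J>p\<close> and \<open>\<J>s\<close>.\<close>

definition traces :: "'a set set" where
  "traces = insert L {H \<inter> F | H. H \<in> planes \<and> L \<subseteq> H}"

definition cut_lines :: "'a set set" where
  "cut_lines = new_lines E I F L traces \<union> traces"

definition cut_planes :: "'a set set" where
  "cut_planes = flats3_above E I traces"

lemma rank_point: "x \<in> E \<Longrightarrow> rk {x} = 1"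
  using loopless by (simp add: loopless_def)

lemma rank_flats_subset_eq:
  "A \<in> rank_flats E I i \<Longrightarrow> B \<in> rank_flats E I i \<Longrightarrow> A \<subseteq> B \<Longrightarrow> A = B"
  by (rule flat_eqI[of A B A]) (auto simp: rank_flats_def)

lemma rank_flats_nonempty: "A \<in> rank_flats E I i \<Longrightarrow> i > 0 \<Longrightarrow> A \<noteq> {}"
  using rank_flatsD(3) by fastforce

lemma rank_flats_proper:
  assumes "A \<in> rank_flats E I i" "i < 4"
  obtains x where "x \<in> E" "x \<notin> A"
  using assms rank_flatsD[OF assms(1)] rank_ground by (metis nat_neq_iff subsetI subset_antisym)

text \<open>Two distinct planes span rank 4, so hypermodularity leaves rank 3 + 3 - 4 = 2 for their
  intersection.\<close>

lemma plane_Int: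
  assumes H: "H \<in> planes" "H' \<in> planes" "H \<noteq> H'"
  shows "H \<inter> H' \<in> lines"
proof -
  have "\<not> H' \<subseteq> H" using rank_flats_subset_eq H by blast
  then obtain x where x: "x \<in> H'" "x \<notin> H" by blast
  have "rk (insert x H) = 4" using flat_insert_rank[of H x] x H rank_flatsD by fastforce
  moreover have "rk (insert x H) \<le> rk (H \<union> H')" by (rule rank_mono) (use x in auto)
  moreover have "rk (H \<union> H') \<le> rk E" by (rule rank_mono) (use H rank_flatsD in blast)
  moreover have "modular_pair I H H'" using hypermodular H rank_ground by (auto simp: hypermodular_def)
  ultimately have "rk (H \<inter> H') = 2" using rank_ground H rank_flatsD(3)
    by (fastforce simp: modular_pair_def)
  then show ?thesis using flat_Int H by (auto simp: rank_flats_def)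
qed

lemma plane_Int_eq:
  assumes "H \<in> planes" "H' \<in> planes" "H \<noteq> H'" "K \<in> lines" "K \<subseteq> H" "K \<subseteq> H'"
  shows "H \<inter> H' = K"
  using rank_flats_subset_eq[OF assms(4) plane_Int[OF assms(1-3)]] assms by blast

lemma plane_eqI:
  assumes "H \<in> planes" "H' \<in> planes" "K \<in> lines" "K \<subseteq> H" "K \<subseteq> H'" "x \<in> H" "x \<in> H'" "x \<notin> K"
  shows "H = H'"
  using plane_Int_eq assms by blast

lemma plane_span:
  assumes "K \<in> lines" "x \<in> E" "x \<notin> K"
  obtains H where "H \<in> planes" "K \<subseteq> H" "x \<in> H"
proof -
  have "rk (insert x K) = 3" "insert x K \<subseteq> E"
    using flat_insert_rank[of K x] assms rank_flatsD[OF assms(1)] by auto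
  then show ?thesis
    using that[of "cl (insert x K)"] rank_flats_closure[of "insert x K"] subset_closure[of "insert x K"]
    by auto
qed

lemma closure_line_Un:
  assumes "K \<in> lines" "K' \<in> lines"
  shows "cl (K \<union> K') \<in> flats E I" "K \<subseteq> cl (K \<union> K')" "K' \<subseteq> cl (K \<union> K')"
  using assms closure_in_flats[of "K \<union> K'"] subset_closure[of "K \<union> K'"] rank_flatsD(2) by auto

lemma not_L_subset_F: "\<not> L \<subseteq> F"
  using disjoint rank_flats_nonempty[OF line_L] by auto

lemma trace_L: "L \<in> traces"
  by (simp add: traces_def)

lemma trace_cases:
  assumes "T \<in> traces"
  obtains "T = L" | H where "T = H \<inter> F" "H \<in> planes" "L \<subseteq> H" "H \<noteq> F"
  using assms not_L_subset_F by (auto simp: traces_def)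

lemma trace_line: "T \<in> traces \<Longrightarrow> T \<in> lines"
  by (erule trace_cases) (use line_L plane_F plane_Int in auto)

lemma trace_subset: "T \<in> traces \<Longrightarrow> T \<subseteq> F \<union> L"
  by (erule trace_cases) auto

text \<open>A point common to \<open>H \<inter> F\<close> and \<open>H' \<inter> F\<close> lies off
  \<open>L\<close>, because \<open>F\<close> and \<open>L\<close> are disjoint; so \<open>H\<close>
  and \<open>H'\<close> are both the plane spanned by \<open>L\<close> and that point.\<close>

lemma trace_eqI:
  assumes "T \<in> traces" "T' \<in> traces" "x \<in> T" "x \<in> T'"
  shows "T = T'"
  using assms(1)
proof (cases rule: trace_cases)
  case 1
  show ?thesis using assms(2) by (cases rule: trace_cases) (use 1 assms disjoint in auto)
next
  case (2 H)
  note H = this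
  show ?thesis using assms(2)
  proof (cases rule: trace_cases)
    case 1
    then show ?thesis using H assms disjoint by auto
  next
    case (2 H')
    then have "H = H'" using plane_eqI[of H H' L x] H line_L assms disjoint by auto
    then show ?thesis using H 2 by simp
  qed
qed

text \<open>The plane spanned by \<open>L\<close> and \<open>x\<close> cuts \<open>F\<close> in a
  trace through \<open>x\<close>.\<close>

lemma trace_cover:
  assumes "x \<in> F"
  obtains T where "T \<in> traces" "x \<in> T" "T \<subseteq> F"
proof -
  have x: "x \<in> E" "x \<notin> L" using assms disjoint rank_flatsD(2)[OF plane_F] by auto
  then obtain H where "H \<in> planes" "L \<subseteq> H" "x \<in> H" using plane_span line_L by blast
  then show ?thesis using that[of "H \<inter> F"] assms by (auto simp: traces_def)
qed

lemma cut_line_line: "J \<in> cut_lines \<Longrightarrow> J \<in> lines"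
  using trace_line by (auto simp: cut_lines_def new_lines_def)

lemma cut_planeI: "H \<in> planes \<Longrightarrow> T \<in> traces \<Longrightarrow> T \<subseteq> H \<Longrightarrow> H \<in> cut_planes"
  by (auto simp: cut_planes_def flats3_above_def)

lemma cut_plane_plane: "H \<in> cut_planes \<Longrightarrow> H \<in> planes"
  by (simp add: cut_planes_def flats3_above_def)

text \<open>The trace below a cut plane \<open>H\<close> can be chosen inside \<open>F\<close>: if
  the given one is \<open>L\<close>, then \<open>H \<inter> F\<close> is itself a trace.\<close>

lemma cut_plane_trace:
  assumes "H \<in> cut_planes"
  obtains T where "T \<in> traces" "T \<subseteq> H" "T \<subseteq> F"
proof -
  obtain T where T: "T \<in> traces" "T \<subseteq> H" using assms by (auto simp: cut_planes_def flats3_above_def)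
  show ?thesis using T(1)
  proof (cases rule: trace_cases)
    case 1
    then show ?thesis using that[of "H \<inter> F"] T cut_plane_plane[OF assms] by (auto simp: traces_def)
  next
    case (2 H)
    then show ?thesis using that T by blast
  qed
qed

lemma finite_rank3_joins: "finite (rank3_joins E I S J)"
  by (rule finite_subset[of _ "Pow E"])
    (use closure_subset_ground finite_ground in \<open>auto simp: rank3_joins_def\<close>)

text \<open>When the common line is not a trace, it has to be a new line: it misses \<open>F\<close>
  and \<open>L\<close>, and \<open>H\<close> and \<open>H'\<close> are two different planes joining
  it to traces.\<close>

lemma cut_plane_Int:
  assumes H: "H \<in> cut_planes" "H' \<in> cut_planes" "H \<noteq> H'"
  shows "H \<inter> H' \<in> cut_lines"
proof -
  obtain T where T: "T \<in> traces" "T \<subseteq> H" "T \<subseteq> F" using H cut_plane_trace by blast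
  obtain T' where T': "T' \<in> traces" "T' \<subseteq> H'" "T' \<subseteq> F" using H cut_plane_trace by blast
  have planes: "H \<in> planes" "H' \<in> planes" using H cut_plane_plane by auto
  note K = plane_Int[OF planes H(3)]
  show ?thesis
  proof (cases "H \<inter> H' \<in> traces")
    case True
    then show ?thesis by (simp add: cut_lines_def)
  next
    case nt: False
    have nT: "\<not> T \<subseteq> H'" "\<not> T' \<subseteq> H"
      using plane_Int_eq[OF planes H(3)] T T' trace_line nt by metis+
    have HF: "H \<inter> F = T" "H' \<inter> F = T'"
      using plane_Int_eq[of H F T] plane_Int_eq[of H' F T'] planes plane_F T T' trace_line nT by auto
    have "T \<inter> T' = {}" using trace_eqI T T' nT by blast
    then have dF: "H \<inter> H' \<inter> F = {}" using HF by blast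
    have dL: "H \<inter> H' \<inter> L = {}"
    proof (rule ccontr)
      assume "H \<inter> H' \<inter> L \<noteq> {}"
      then obtain p where p: "p \<in> H" "p \<in> H'" "p \<in> L" by blast
      \<comment> \<open>The trace \<open>S\<close> is cut out of \<open>F\<close> by a plane
        \<open>B\<close> above \<open>L\<close>. Both \<open>B\<close> and \<open>G\<close> contain
        \<open>S\<close> and the point \<open>p\<close> off \<open>S\<close>, so they agree. A point
        of \<open>L\<close> on both \<open>H\<close> and \<open>H'\<close> would thus make their
        intersection the trace \<open>L\<close>.\<close>
      have "L \<subseteq> G" if G: "G \<in> planes" "p \<in> G" "S \<in> traces" "S \<subseteq> G" "S \<subseteq> F" for G S
        using G(3)
      proof (cases rule: trace_cases)
        case 1
        then show ?thesis using G by simp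
      next
        case (2 B)
        have "p \<notin> S" using G p disjoint by blast
        then have "G = B" using plane_eqI[of G B S p] G p 2 trace_line by blast
        then show ?thesis using 2 by simp
      qed
      then have "L \<subseteq> H" "L \<subseteq> H'" using planes p T T' by blast+
      then have "H \<inter> H' = L" using plane_Int_eq[OF planes H(3)] line_L by blast
      then show False using nt by (simp add: traces_def)
    qed
    \<comment> \<open>A trace inside \<open>G\<close> other than the common line has a point off
      that line, so together the two already span \<open>G\<close>.\<close>
    have join: "G \<in> rank3_joins E I traces (H \<inter> H')"
      if G: "G \<in> planes" "H \<inter> H' \<subseteq> G" "S \<in> traces" "S \<subseteq> G" for G S
    proof -
      have "S \<noteq> H \<inter> H'" using G nt by blast
      then obtain s where s: "s \<in> S" "s \<notin> H \<inter> H'"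
        using rank_flats_subset_eq trace_line[OF G(3)] K by blast
      have sub: "H \<inter> H' \<union> S \<subseteq> G" "G \<subseteq> E" using G rank_flatsD(2) by auto
      then have "s \<in> E" using s by blast
      have "rk (insert s (H \<inter> H')) = 3"
        using flat_insert_rank[OF rank_flatsD(1)[OF K] \<open>s \<in> E\<close> s(2)] rank_flatsD(3)[OF K] by simp
      moreover have "rk (insert s (H \<inter> H')) \<le> rk (H \<inter> H' \<union> S)" by (rule rank_mono) (use s in auto)
      moreover have "rk (H \<inter> H' \<union> S) \<le> rk G" using sub rank_mono by blast
      ultimately have r: "rk (H \<inter> H' \<union> S) = 3" using rank_flatsD(3)[OF G(1)] by simp
      have "cl (H \<inter> H' \<union> S) = cl G"
        by (rule closure_eqI) (use r sub rank_flatsD(3)[OF G(1)] in auto)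
      then have "G = cl (H \<inter> H' \<union> S)" using flatD(2) rank_flatsD(1)[OF G(1)] by simp
      then show ?thesis using r G(3) by (auto simp: rank3_joins_def)
    qed
    have "card {H, H'} \<le> card (rank3_joins E I traces (H \<inter> H'))"
      by (rule card_mono) (use finite_rank3_joins join planes T T' in auto)
    then have "card (rank3_joins E I traces (H \<inter> H')) \<ge> 2" using H by simp
    then show ?thesis using K dF dL rank_flatsD(2)[OF K]
      by (auto simp: cut_lines_def new_lines_def)
  qed
qed

text \<open>For \<open>x\<close> outside \<open>F \<union> L\<close>, intersect the plane spanned by
  \<open>L\<close> and \<open>x\<close> with the plane spanned by \<open>x\<close> and a trace not
  contained in the first plane.\<close>

lemma point_on_cut_line:
  assumes "x \<in> E"
  obtains J where "J \<in> cut_lines" "x \<in> J"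
proof (cases "x \<in> F \<union> L")
  case True
  then have "\<exists>T\<in>traces. x \<in> T" using trace_cover[of x] trace_L by (metis Un_iff)
  then show ?thesis using that by (auto simp: cut_lines_def)
next
  case False
  obtain H where H: "H \<in> planes" "L \<subseteq> H" "x \<in> H" using plane_span[OF line_L assms] False by blast
  then have "\<not> F \<subseteq> H" using rank_flats_subset_eq[OF plane_F H(1)] not_L_subset_F by blast
  \<comment> \<open>The trace through a point of \<open>F\<close> off \<open>H\<close> guarantees
    that the second plane differs from \<open>H\<close>.\<close>
  then obtain f where f: "f \<in> F" "f \<notin> H" by blast
  then obtain T where T: "T \<in> traces" "f \<in> T" "T \<subseteq> F" using trace_cover by blast
  have "x \<notin> T" using T False by blast
  then obtain H' where H': "H' \<in> planes" "T \<subseteq> H'" "x \<in> H'"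
    using plane_span[OF trace_line[OF T(1)] assms] by blast
  have "H \<in> cut_planes" using cut_planeI[OF H(1), of L] H(2) by (simp add: traces_def)
  moreover have "H' \<in> cut_planes" using cut_planeI H' T by blast
  moreover have "H \<noteq> H'" using f H' T by blast
  ultimately show ?thesis using that cut_plane_Int H H' by blast
qed

end

section \<open>Consequences of coplanarity of the cut lines\<close>

locale coplanar_cut_lines = disjoint_plane_line +
  assumes coplanar: "J \<in> cut_lines \<Longrightarrow> J' \<in> cut_lines \<Longrightarrow> J \<noteq> J' \<Longrightarrow>
    mclosure E I (J \<union> J') \<in> cut_planes"
begin

lemma trace_cut_line: "T \<in> traces \<Longrightarrow> T \<in> cut_lines"
  by (simp add: cut_lines_def)

lemma coplanar_obtain:
  assumes "J \<in> cut_lines" "J' \<in> cut_lines" "J \<noteq> J'"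
  obtains H where "H \<in> cut_planes" "J \<subseteq> H" "J' \<subseteq> H"
  using that coplanar[OF assms] closure_line_Un[of J J'] assms cut_line_line by blast

text \<open>A new line \<open>J\<close> misses \<open>F\<close>, while \<open>H\<close> meets
  \<open>F\<close> in some point \<open>f\<close>. The cut plane spanned by \<open>J\<close> and the
  trace through \<open>f\<close> contains \<open>J\<close> and \<open>f\<close>, hence equals
  \<open>H\<close>.\<close>

lemma plane_above_cut_line:
  assumes J: "J \<in> cut_lines" and H: "H \<in> planes" "J \<subseteq> H"
  shows "H \<in> cut_planes"
proof (cases "J \<in> traces")
  case True
  then show ?thesis using cut_planeI H by blast
next
  case False
  then have JF: "J \<inter> F = {}" using J by (auto simp: cut_lines_def new_lines_def)
  have "J \<noteq> {}" using rank_flats_nonempty cut_line_line J by fastforce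
  then have "H \<noteq> F" using H JF by blast
  then have "H \<inter> F \<noteq> {}" using rank_flats_nonempty[OF plane_Int[OF H(1) plane_F]] by simp
  then obtain f where f: "f \<in> H" "f \<in> F" by blast
  then obtain T where T: "T \<in> traces" "f \<in> T" using trace_cover by blast
  have fJ: "f \<notin> J" using f JF by blast
  then obtain G where G: "G \<in> cut_planes" "J \<subseteq> G" "T \<subseteq> G"
    using coplanar_obtain[OF J trace_cut_line[OF T(1)]] T by blast
  then have "H = G" using plane_eqI[of H G J f] H cut_plane_plane cut_line_line J f T fJ by blast
  then show ?thesis using G by simp
qed

text \<open>Compare \<open>H\<close> with the plane \<open>P\<close> spanned by \<open>J\<close> and
  a trace \<open>T\<close> inside \<open>H\<close>. If they differed, they would meet exactly in
  \<open>T\<close>, putting \<open>x\<close> on \<open>T\<close>; but a cut line other than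
  \<open>T\<close> is disjoint from \<open>T\<close>.\<close>

lemma cut_line_subset_cut_plane:
  assumes J: "J \<in> cut_lines" and H: "H \<in> cut_planes" and x: "x \<in> J" "x \<in> H"
  shows "J \<subseteq> H"
proof -
  obtain T where T: "T \<in> traces" "T \<subseteq> H" using cut_plane_trace H by blast
  show ?thesis
  proof (cases "J = T")
    case True
    then show ?thesis using T by simp
  next
    case ne: False
    then obtain P where P: "P \<in> cut_planes" "J \<subseteq> P" "T \<subseteq> P"
      using coplanar_obtain[OF J trace_cut_line[OF T(1)]] by blast
    have "P = H"
    proof (rule ccontr)
      assume "P \<noteq> H"
      then have "P \<inter> H = T" using plane_Int_eq P T cut_plane_plane H trace_line by blast
      then have xT: "x \<in> T" using P x by blast
      then show False
        using J ne x trace_eqI[OF _ T(1) _ xT, of J] trace_subset[OF T(1)]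
        by (auto simp: cut_lines_def new_lines_def)
    qed
    then show ?thesis using P by simp
  qed
qed

text \<open>Take a second plane \<open>H\<close> through \<open>J\<close>, different from the plane
  \<open>P\<close> of both lines. It is a cut plane meeting \<open>J'\<close> in \<open>x\<close>,
  so it contains \<open>J'\<close>, and \<open>J'\<close> is squeezed into
  \<open>H \<inter> P\<close>, which is \<open>J\<close>.\<close>

lemma cut_lines_disjoint:
  assumes J: "J \<in> cut_lines" and J': "J' \<in> cut_lines" and x: "x \<in> J" "x \<in> J'"
  shows "J = J'"
proof (rule ccontr)
  assume ne: "J \<noteq> J'"
  then obtain P where P: "P \<in> cut_planes" "J \<subseteq> P" "J' \<subseteq> P" using coplanar_obtain J J' by blast
  obtain z where z: "z \<in> E" "z \<notin> P" using rank_flats_proper[OF cut_plane_plane[OF P(1)]] by auto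
  obtain H where H: "H \<in> planes" "J \<subseteq> H" "z \<in> H"
    using plane_span[OF cut_line_line[OF J] z(1)] z P by blast
  then have "H \<in> cut_planes" using plane_above_cut_line J by blast
  then have "J' \<subseteq> H" using cut_line_subset_cut_plane[OF J'] x H by blast
  then have "J' \<subseteq> J" using plane_Int_eq[of H P J] H P cut_plane_plane cut_line_line J z by blast
  then show False using rank_flats_subset_eq cut_line_line J J' ne by blast
qed

text \<open>A cut line \<open>J\<close> through a point of \<open>K\<close> spans with another point
  of \<open>K\<close> a plane above \<open>J\<close>; that plane is a cut plane and contains
  \<open>K\<close>.\<close>

lemma line_in_cut_plane:
  assumes K: "K \<in> lines"
  obtains H where "H \<in> cut_planes" "K \<subseteq> H"
proof -
  obtain e where e: "e \<in> K" using rank_flats_nonempty[OF K] by auto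
  have eE: "e \<in> E" using e rank_flatsD(2)[OF K] by blast
  obtain J where J: "J \<in> cut_lines" "e \<in> J" using point_on_cut_line eE by blast
  note lJ = cut_line_line[OF J(1)]
  show ?thesis
  proof (cases "K \<subseteq> J")
    case True
    then have "K = J" using rank_flats_subset_eq K lJ by blast
    moreover obtain z where "z \<in> E" "z \<notin> J" using rank_flats_proper[OF lJ] by auto
    ultimately show ?thesis using that plane_span[OF lJ] plane_above_cut_line[OF J(1)] by metis
  next
    case False
    then obtain f where f: "f \<in> K" "f \<notin> J" by blast
    have fE: "f \<in> E" using f rank_flatsD(2)[OF K] by blast
    obtain H where H: "H \<in> planes" "J \<subseteq> H" "f \<in> H" using plane_span[OF lJ fE f(2)] by blast
    \<comment> \<open>Parallel elements are allowed, so \<open>f\<close> being different from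
      \<open>e\<close> is not enough. Since \<open>f\<close> is off \<open>J\<close>, it is not
      parallel to \<open>e\<close>, and the two span \<open>K\<close>.\<close>
    have "cl {e} \<subseteq> J" using closure_subset_flat J rank_flatsD(1)[OF lJ] by simp
    then have "f \<notin> cl {e}" using f by blast
    then have "rk {f, e} \<noteq> 1" using fE rank_point[OF eE] by (auto simp: mclosure_def)
    then have "2 \<le> rk {f, e}" using rank_insert_ge[of "{e}" f] rank_point[OF eE] by linarith
    then have "K \<subseteq> H"
      using subset_flatI[of H "{f, e}" K] H J e f rank_flatsD[OF K] rank_flatsD(1)[OF H(1)] by auto
    then show ?thesis using that plane_above_cut_line[OF J(1) H(1,2)] by blast
  qed
qed

end

section \<open>The modular cut of coplanar lines and the extension it determines\<close>

locale coplanar_extension = coplanar_cut_lines +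
  fixes m :: 'a
  assumes new: "m \<notin> E"
begin

definition cut :: "'a set set" where "cut = insert E (cut_planes \<union> cut_lines)"

lemma flat_rank_le: "A \<in> flats E I \<Longrightarrow> rk A \<le> 4"
  using rank_mono[of A E] flatD(1) rank_ground by auto

lemma flat_rank_4: "A \<in> flats E I \<Longrightarrow> rk A = 4 \<Longrightarrow> A = E"
  using flat_eqI[of A E A] ground_flat flatD(1) rank_ground by auto

lemma flat_rank_0: "A \<in> flats E I \<Longrightarrow> rk A = 0 \<Longrightarrow> A = {}"
  using rank_mono[of "{_}" A] rank_point flatD(1)[of A] by fastforce

lemma empty_flat: "{} \<in> flats E I"
  using rank_point by (intro flatI) auto

lemma ground_cut: "E \<in> cut"
  by (simp add: cut_def)

lemma cut_rank_3: "A \<in> planes \<Longrightarrow> A \<in> cut \<longleftrightarrow> A \<in> cut_planes"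
  using rank_flatsD(3)[of A 3] rank_flatsD(3)[of A 2] cut_line_line[of A] rank_ground
  by (auto simp: cut_def)

lemma cut_rank_2: "A \<in> lines \<Longrightarrow> A \<in> cut \<longleftrightarrow> A \<in> cut_lines"
  using rank_flatsD(3)[of A 3] rank_flatsD(3)[of A 2] cut_plane_plane[of A] rank_ground
  by (auto simp: cut_def)

lemma cut_cases:
  assumes "A \<in> cut"
  obtains "A = E" | "A \<in> cut_planes" "A \<in> planes" | "A \<in> cut_lines" "A \<in> lines"
  using assms cut_plane_plane cut_line_line by (auto simp: cut_def)

lemma cut_rank: "A \<in> cut \<Longrightarrow> 2 \<le> rk A"
  by (erule cut_cases) (use rank_ground rank_flatsD(3) in fastforce)+

lemma cut_subset_flats: "cut \<subseteq> flats E I"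
  using ground_flat rank_flatsD(1) by (auto elim!: cut_cases)

text \<open>Equal rank forces \<open>B = A\<close> and rank 4 forces \<open>B = E\<close>. The only
  other possibility is a plane above a cut line.\<close>

lemma cut_upward:
  assumes A: "A \<in> cut" and B: "B \<in> flats E I" "A \<subseteq> B"
  shows "B \<in> cut"
proof (cases "rk A = rk B \<or> rk B = 4")
  case True
  then show ?thesis
    using flat_eqI[of A B A] A B cut_subset_flats flat_rank_4[OF B(1)] by (auto simp: cut_def)
next
  case False
  have lt: "rk A < rk B" "rk B < 4"
    using False rank_mono[OF B(2)] flat_rank_le[OF B(1)] by auto
  show ?thesis using A
  proof (cases rule: cut_cases)
    case 3
    then have "B \<in> planes" using lt B rank_flatsD(3)[of A 2] by (simp add: rank_flats_def)
    then show ?thesis using plane_above_cut_line 3 B by (auto simp: cut_def)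
  qed (use lt rank_ground rank_flatsD(3)[of A 3] in auto)
qed

text \<open>The intersection condition has content only for planes, where it is
  \<open>cut_plane_Int\<close>. There is a single flat of rank 4, and distinct cut lines are
  disjoint, so their intersection never has the required rank 1.\<close>

sublocale modular_cut E I cut m
proof
  fix A B assume AB: "A \<in> cut" "B \<in> cut" "rk A = rk B" "rk (A \<union> B) = rk A + 1" "rk (A \<inter> B) + 1 = rk A"
  then have ne: "A \<noteq> B" by auto
  show "A \<inter> B \<in> cut" using AB(1)
  proof (cases rule: cut_cases)
    case 1
    then show ?thesis using AB ne rank_ground flat_rank_4[of B] cut_subset_flats by auto
  next
    case 2
    then have "B \<in> planes" using AB cut_subset_flats rank_flatsD(3)[of A 3] by (auto simp: rank_flats_def)
    then show ?thesis using cut_plane_Int 2 AB(2) ne cut_rank_3 by (auto simp: cut_def)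
  next
    case 3
    then have "B \<in> lines" using AB cut_subset_flats rank_flatsD(3)[of A 2] by (auto simp: rank_flats_def)
    then have "A \<inter> B = {}" using cut_lines_disjoint 3 AB(2) ne cut_rank_2 by blast
    then show ?thesis using AB(5) 3 rank_flatsD(3)[of A 2] by simp
  qed
qed (use cut_subset_flats cut_upward new in auto)

text \<open>Points lie on cut lines, lines in cut planes, and planes in \<open>E\<close>. This
  excludes the second alternative of \<open>flats_ext_insert\<close> for every nonempty flat outside
  the cut, leaving only the new flat \<open>{m}\<close>.\<close>

lemma covered_by_cut:
  assumes Y: "Y \<in> flats E I" "Y \<noteq> {}" "Y \<notin> cut"
  shows "\<exists>x\<in>E - Y. cl (insert x Y) \<in> cut"
proof -
  obtain B where B: "B \<in> cut" "Y \<subseteq> B" "rk B = rk Y + 1"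
  proof -
    have "rk Y \<noteq> 0" "rk Y \<noteq> 4" using Y flat_rank_0 flat_rank_4 by (auto simp: cut_def)
    then consider "rk Y = 1" | "rk Y = 2" | "rk Y = 3" using flat_rank_le[OF Y(1)] by linarith
    then show ?thesis
    proof cases
      case 1
      obtain y where y: "y \<in> Y" using Y by blast
      then obtain J where J: "J \<in> cut_lines" "y \<in> J" using point_on_cut_line flatD(1)[OF Y(1)] by blast
      note lJ = cut_line_line[OF J(1)]
      have "Y \<subseteq> J"
        by (rule subset_flatI[of J "{y}"])
          (use J y 1 rank_flatsD(1)[OF lJ] flatD(1)[OF Y(1)] rank_point in auto)
      then show ?thesis using that[of J] J 1 rank_flatsD(3)[OF lJ] by (auto simp: cut_def)
    next
      case 2
      then have "Y \<in> lines" using Y by (simp add: rank_flats_def)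
      then obtain H where "H \<in> cut_planes" "Y \<subseteq> H" using line_in_cut_plane by blast
      then show ?thesis using that[of H] 2 cut_plane_plane rank_flatsD(3)[of H 3] by (auto simp: cut_def)
    next
      case 3
      then show ?thesis using that[of E] flatD(1)[OF Y(1)] rank_ground by (auto simp: cut_def)
    qed
  qed
  have BE: "B \<in> flats E I" using B cut_subset_flats by blast
  have "\<not> B \<subseteq> Y" using B rank_mono[of B Y] by auto
  then obtain x where x: "x \<in> B" "x \<notin> Y" by blast
  then have xE: "x \<in> E" using flatD(1)[OF BE] by blast
  have "cl (insert x Y) = cl B"
    by (rule closure_eqI) (use x B flatD(1)[OF BE] flat_insert_rank[OF Y(1) xE x(2)] in auto)
  then show ?thesis using x xE B flatD(2)[OF BE] by auto
qed

section \<open>The flats of the extension, rank by rank\<close>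

lemma empty_not_cut: "{} \<notin> cut"
  using cut_rank[of "{}"] by auto

lemma rank_new_point: "ext.rk {m} = 1"
  using rank_ext_insert[of "{}"] flatD(2)[OF empty_flat] empty_not_cut by simp

lemma new_point_flat: "{m} \<in> flats (insert m E) Iext"
proof -
  have "cl {x} \<notin> cut" if "x \<in> E" for x
    using cut_rank[of "cl {x}"] rank_closure[of "{x}"] rank_point[OF that] that by auto
  then show ?thesis using flats_ext_insert[of "{}"] empty_flat by simp
qed

lemma flats_ext: "flats (insert m E) Iext = insert {m} (lift ` flats E I)"
proof
  show "flats (insert m E) Iext \<subseteq> insert {m} (lift ` flats E I)"
  proof
    fix X assume X: "X \<in> flats (insert m E) Iext"
    show "X \<in> insert {m} (lift ` flats E I)"
    proof (cases "m \<in> X")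
      case True
      define Y where "Y = X - {m}"
      have Y: "X = insert m Y" "Y \<subseteq> E" using True ext.flatD(1)[OF X] by (auto simp: Y_def)
      then have "Y \<in> flats E I" "Y \<in> cut \<or> (\<forall>x\<in>E - Y. cl (insert x Y) \<notin> cut)"
        using X flats_ext_insert by auto
      then show ?thesis using covered_by_cut[of Y] Y by (auto simp: lift_def image_iff)
    next
      case False
      then have "X \<subseteq> E" using ext.flatD(1)[OF X] by auto
      then show ?thesis using X flats_ext_ground by (auto simp: lift_def image_iff)
    qed
  qed
qed (use lift_flat new_point_flat in auto)

lemma rank_flats_ext:
  "rank_flats (insert m E) Iext i = lift ` rank_flats E I i \<union> (if i = 1 then {{m}} else {})"
  using rank_lift rank_new_point by (auto simp: rank_flats_def flats_ext)

lemma lift_image: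
  assumes "\<And>A. A \<in> S \<Longrightarrow> A \<in> cut \<longleftrightarrow> A \<in> D" "D \<subseteq> S"
  shows "lift ` S = (S - D) \<union> {J \<union> {m} | J. J \<in> D}"
proof -
  have "lift ` (S - D) = S - D" using assms(1) by (auto simp: lift_def image_iff)
  moreover have "lift ` D = {J \<union> {m} | J. J \<in> D}" using assms by (auto simp: lift_def image_iff)
  moreover have "lift ` S = lift ` (S - D) \<union> lift ` D" using assms(2) by blast
  ultimately show ?thesis by simp
qed

lemma rank_flats_ext_4: "rank_flats (insert m E) Iext 4 = {insert m E}"
proof -
  have "rank_flats E I 4 = {E}" using flat_rank_4 ground_flat rank_ground by (auto simp: rank_flats_def)
  moreover have "lift E = insert m E" by (simp add: lift_def ground_cut)
  ultimately show ?thesis by (simp add: rank_flats_ext)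
qed

lemma rank_flats_ext_3:
  "rank_flats (insert m E) Iext 3 = (planes - cut_planes) \<union> {J \<union> {m} | J. J \<in> cut_planes}"
  using lift_image[of planes cut_planes] cut_rank_3 cut_plane_plane by (simp add: rank_flats_ext subsetI)

lemma rank_flats_ext_2:
  "rank_flats (insert m E) Iext 2 = (lines - cut_lines) \<union> {J \<union> {m} | J. J \<in> cut_lines}"
  using lift_image[of lines cut_lines] cut_rank_2 cut_line_line by (simp add: rank_flats_ext subsetI)

lemma rank_flats_ext_1: "rank_flats (insert m E) Iext 1 = rank_flats E I 1 \<union> {{m}}"
proof -
  have "lift ` rank_flats E I 1 = rank_flats E I 1"
    using cut_rank rank_flatsD(3) by (fastforce simp: lift_def)
  then show ?thesis by (simp add: rank_flats_ext)
qed

lemma rank_flats_ext_0: "rank_flats (insert m E) Iext 0 = {{}}"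
proof -
  have "rank_flats E I 0 = {{}}" using flat_rank_0 empty_flat by (auto simp: rank_flats_def)
  then show ?thesis using empty_not_cut by (simp add: rank_flats_ext lift_def)
qed

lemma rank_ext_total: "ext.rk (insert m E) = 4"
  using rank_ext_cut[OF ground_cut] rank_ground by simp

text \<open>All planes of the extension are lifts. Lifting keeps the ranks of flats and of unions
  and cannot lower those of intersections, so modularity survives; submodularity supplies the
  reverse inequality.\<close>

lemma hypermodular_ext: "hypermodular (insert m E) Iext"
proof -
  have "modular_pair Iext X Y"
    if XY: "X \<in> rank_flats (insert m E) Iext 3" "Y \<in> rank_flats (insert m E) Iext 3" for X Y
  proof -
    obtain A B where AB: "X = lift A" "Y = lift B" "A \<in> planes" "B \<in> planes"
      using XY by (auto simp: rank_flats_ext)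
    then have fl: "A \<in> flats E I" "B \<in> flats E I" using rank_flatsD by blast+
    have "rk (A \<union> B) + rk (A \<inter> B) = rk A + rk B"
      using hypermodular AB rank_ground by (auto simp: hypermodular_def modular_pair_def)
    then have "ext.rk X + ext.rk Y \<le> ext.rk (X \<union> Y) + ext.rk (X \<inter> Y)"
      unfolding AB(1,2)
      using rank_lift[OF fl(1)] rank_lift[OF fl(2)] rank_lift_Un[OF fl] rank_lift_Int[OF fl] by linarith
    then show ?thesis using ext.rank_submodular[of X Y] by (simp add: modular_pair_def)
  qed
  then show ?thesis using rank_ext_total by (simp add: hypermodular_def)
qed

section \<open>Modular defects of the extension\<close>

lemma new_point_modular:
  assumes "B \<in> flats (insert m E) Iext"
  shows "modular_defect Iext {m} B = 0"
proof (cases "m \<in> B")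
  case True
  then have "{m} \<union> B = B" "{m} \<inter> B = {m}" by auto
  then show ?thesis by (simp add: modular_defect_def)
next
  case False
  then have "{m} \<inter> B = {}" by auto
  then show ?thesis
    using False ext.flat_insert_rank[OF assms, of m] rank_new_point ext.rank_empty
    by (simp add: modular_defect_def)
qed

lemma modular_defect_lift:
  assumes "A \<in> flats E I" "B \<in> flats E I"
  shows "modular_defect Iext (lift A) (lift B) \<le> modular_defect I A B"
  using rank_lift rank_lift_Un rank_lift_Int assms by (simp add: modular_defect_def)

text \<open>
  Lifting matches the flats of the matroid with those of the extension other than \<open>{m}\<close>, and
  \<open>{m}\<close> forms a modular pair with every flat.
\<close>

lemma total_modular_defect_ext:
  "total_modular_defect (insert m E) Iext < total_modular_defect E I"
proof -
  define S where "S = {P. P \<subseteq> flats E I \<and> card P = 2}"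
  define S' where "S' = {P. P \<subseteq> flats (insert m E) Iext \<and> card P = 2}"
  have fin: "finite S" "finite S'"
    using finite_flats ext.finite_flats by (auto simp: S_def S'_def)
  have card_lift: "card (lift ` P) = card P" if "P \<subseteq> flats E I" for P
    using card_image inj_on_subset[OF inj_on_lift that] by blast
  have sub: "(`) lift ` S \<subseteq> S'"
    using card_lift lift_flat by (auto simp: S_def S'_def)
  have zero: "pair_defect Iext P = 0" if P: "P \<in> S' - (`) lift ` S" for P
  proof -
    \<comment> \<open>A pair avoiding \<open>{m}\<close> consists of lifts, so it would be the image
      of an old pair.\<close>
    have "{m} \<in> P"
    proof (rule ccontr)
      assume "{m} \<notin> P"
      then have "P \<subseteq> lift ` flats E I" using P by (auto simp: S'_def flats_ext)
      then obtain Q where Q: "Q \<subseteq> flats E I" "P = lift ` Q" by (meson subset_image_iff)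
      then have "Q \<in> S" using P card_lift by (simp add: S_def S'_def)
      then show False using P Q by blast
    qed
    moreover obtain X Y where XY: "P = {X, Y}" "X \<noteq> Y" using P by (auto simp: S'_def card_2_iff)
    ultimately obtain B where "P = {{m}, B}" "B \<noteq> {m}" by blast
    then show ?thesis
      using pair_defect_doubleton[of "{m}" B Iext] new_point_modular P by (auto simp: S'_def)
  qed
  have pair: "pair_defect Iext (lift ` {X, Y}) = modular_defect Iext (lift X) (lift Y)"
    if "X \<in> flats E I" "Y \<in> flats E I" "X \<noteq> Y" for X Y
  proof -
    have "lift X \<noteq> lift Y" using inj_on_lift that by (meson inj_on_contraD)
    then show ?thesis using pair_defect_doubleton by simp
  qed
  have le: "pair_defect Iext (lift ` P) \<le> pair_defect I P" if P: "P \<in> S" for P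
  proof -
    obtain X Y where "P = {X, Y}" "X \<noteq> Y" using P by (auto simp: S_def card_2_iff)
    moreover from this have "X \<in> flats E I" "Y \<in> flats E I" using P by (auto simp: S_def)
    ultimately show ?thesis using pair modular_defect_lift pair_defect_doubleton by metis
  qed
  have FL: "F \<in> flats E I" "L \<in> flats E I" "F \<noteq> L"
    using plane_F line_L rank_flatsD(1) not_L_subset_F by auto
  \<comment> \<open>The pair of \<open>F\<close> and \<open>L\<close> supplies the strict drop: both
    are in the cut, so the intersection of their lifts has rank at least 1 instead of 0.\<close>
  have "L \<in> cut" using trace_L trace_cut_line by (simp add: cut_def)
  moreover have "F \<in> cut"
  proof -
    obtain x where "x \<in> F" using rank_flats_nonempty[OF plane_F] by auto
    then obtain T where "T \<in> traces" "T \<subseteq> F" using trace_cover by blast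
    then show ?thesis using cut_planeI plane_F by (auto simp: cut_def)
  qed
  ultimately have "m \<in> lift F \<inter> lift L" by (simp add: lift_def)
  then have "ext.rk {m} \<le> ext.rk (lift F \<inter> lift L)" by (intro ext.rank_mono) auto
  then have "modular_defect Iext (lift F) (lift L) < modular_defect I F L"
    using FL rank_lift rank_lift_Un disjoint rank_new_point by (simp add: modular_defect_def)
  then have "pair_defect Iext (lift ` {F, L}) < pair_defect I {F, L}"
    using pair[OF FL] pair_defect_doubleton[OF FL(3), of I] by simp
  moreover have "{F, L} \<in> S" using FL by (simp add: S_def)
  ultimately have lt: "\<exists>P\<in>S. pair_defect Iext (lift ` P) < pair_defect I P" by blast
  have inj: "inj_on ((`) lift) S"
    using inj_on_subset[OF inj_on_image_Pow[OF inj_on_lift], of S] by (auto simp: S_def)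
  have "total_modular_defect (insert m E) Iext = (\<Sum>P\<in>S'. pair_defect Iext P)"
    by (simp add: total_modular_defect_def S'_def)
  also have "\<dots> = (\<Sum>P\<in>(`) lift ` S. pair_defect Iext P)"
    using sum.mono_neutral_right[OF fin(2) sub] zero by blast
  also have "\<dots> = (\<Sum>P\<in>S. pair_defect Iext (lift ` P))"
    using sum.reindex[OF inj] by simp
  also have "\<dots> < (\<Sum>P\<in>S. pair_defect I P)"
    using sum_strict_mono_ex1[OF fin(1) _ lt] le by blast
  finally show ?thesis by (simp add: total_modular_defect_def S_def)
qed

end

section \<open>Coplanarity forced by an extension with the prescribed flats\<close>

lemma (in disjoint_plane_line) coplanar_if_extension:
  assumes ext: "matroid (insert m E) I'" and restrict: "mrestrict I' E = I" and m: "m \<notin> E"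
    and planes: "rank_flats (insert m E) I' 3 = (planes - cut_planes) \<union> {J \<union> {m} | J. J \<in> cut_planes}"
    and lines: "rank_flats (insert m E) I' 2 = (lines - cut_lines) \<union> {J \<union> {m} | J. J \<in> cut_lines}"
    and points: "rank_flats (insert m E) I' 1 = rank_flats E I 1 \<union> {{m}}"
    and J: "J \<in> cut_lines" "J' \<in> cut_lines" "J \<noteq> J'"
  shows "cl (J \<union> J') \<in> cut_planes"
proof -
  interpret ext: matroid "insert m E" I' by (rule ext)
  have rk_eq: "ext.rk X = rk X" if "X \<subseteq> E" for X
    using mrank_mrestrict[OF that, of I'] restrict by simp
  note lJ = cut_line_line[OF J(1)] cut_line_line[OF J(2)]
  have sub: "J \<union> J' \<subseteq> E" using lJ rank_flatsD(2) by auto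
  obtain x where x: "x \<in> J'" "x \<notin> J" using rank_flats_subset_eq[OF lJ(2,1)] J(3) by blast
  have "rk (insert x J) = 3"
    using flat_insert_rank[of J x] x sub rank_flatsD[OF lJ(1)] by auto
  moreover have "rk (insert x J) \<le> rk (J \<union> J')" by (rule rank_mono) (use x in auto)
  moreover have "rk (J \<union> J') \<le> ext.rk (insert m (J \<union> J'))"
    using ext.rank_insert_ge[of "J \<union> J'" m] rk_eq[OF sub] by simp
  \<comment> \<open>Both lines gain \<open>m\<close> without gaining rank, and their intersection
    now has rank at least 1, so submodularity bounds the rank of the union by 2 + 2 - 1.\<close>
  moreover have "ext.rk (insert m (J \<union> J')) \<le> 3"
  proof -
    have "insert m J \<in> rank_flats (insert m E) I' 2" "insert m J' \<in> rank_flats (insert m E) I' 2"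
      using lines J by auto
    then have "ext.rk (insert m J) = 2" "ext.rk (insert m J') = 2" using ext.rank_flatsD(3) by blast+
    moreover have "{m} \<in> rank_flats (insert m E) I' 1" using points by blast
    then have "ext.rk {m} = 1" using ext.rank_flatsD(3) by blast
    moreover have "ext.rk {m} \<le> ext.rk (insert m J \<inter> insert m J')" by (rule ext.rank_mono) auto
    moreover have "insert m J \<union> insert m J' = insert m (J \<union> J')" by auto
    ultimately show ?thesis using ext.rank_submodular[of "insert m J" "insert m J'"] by simp
  qed
  ultimately have r: "rk (J \<union> J') = 3" "ext.rk (insert m (J \<union> J')) = 3" by linarith+
  let ?G = "ext.cl (insert m (J \<union> J'))"
  have subG: "insert m (J \<union> J') \<subseteq> ?G" by (rule ext.subset_closure) (use sub in auto)
  have "?G \<in> rank_flats (insert m E) I' 3"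
    using ext.rank_flats_closure[of "insert m (J \<union> J')"] sub r by auto
  \<comment> \<open>The plane \<open>?G\<close> contains \<open>m\<close>, so the prescribed list of
    planes makes it \<open>H \<union> {m}\<close> for a cut plane \<open>H\<close>. Then
    \<open>H\<close> contains both lines and has the rank of their union.\<close>
  moreover have "?G \<notin> rank_flats E I 3" using subG m rank_flatsD(2) by blast
  ultimately obtain H where H: "H \<in> cut_planes" "?G = H \<union> {m}" using planes by blast
  note pH = cut_plane_plane[OF H(1)]
  have "J \<union> J' \<subseteq> H" using subG H(2) sub m by blast
  then have "cl (J \<union> J') = cl H"
    using closure_eqI[of "J \<union> J'" H] r rank_flatsD[OF pH] by simp
  then show ?thesis using H flatD(2) rank_flatsD(1)[OF pH] by simp
qed

theorem theorem4p5:
  fixes E :: "'a set" and I :: "'a set \<Rightarrow> bool" and m :: 'a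
    and F L :: "'a set" and n :: nat and A T :: "nat \<Rightarrow> 'a set"
    and \<T> \<J> \<J>p \<J>s :: "'a set set"
  assumes "matroid E I"
    and "loopless E I"
    and "mrank I E = 4"
    and "hypermodular E I"
    and "\<not> modular_matroid E I"
    and "F \<in> rank_flats E I 3"
    and "L \<in> rank_flats E I 2"
    and "F \<inter> L = {}"
    and "bij_betw A {1..n} {H \<in> rank_flats E I 3. L \<subseteq> H}"
    and "T 0 = L"
    and "\<forall>i\<in>{1..n}. T i = A i \<inter> F"
    and "\<T> = T ` {0..n}"
    and "\<J> = new_lines E I F L \<T>"
    and "\<J>p = \<J> \<union> \<T>"
    and "\<J>s = flats3_above E I \<T>"
    and "m \<notin> E"
  shows
    "{mclosure E I (J \<union> J') | J J'. J \<in> \<J>p \<and> J' \<in> \<J>p \<and> J \<noteq> J'} \<subseteq> \<J>s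
     \<longleftrightarrow>
     (\<exists>Im. matroid (E \<union> {m}) Im
        \<and> mrank Im (E \<union> {m}) = 4
        \<and> hypermodular (E \<union> {m}) Im
        \<and> mrestrict Im E = I
        \<and> total_modular_defect (E \<union> {m}) Im < total_modular_defect E I
        \<and> rank_flats (E \<union> {m}) Im 4 = {E \<union> {m}}
        \<and> rank_flats (E \<union> {m}) Im 0 = {{}}
        \<and> rank_flats (E \<union> {m}) Im 3 = (rank_flats E I 3 - \<J>s) \<union> {J \<union> {m} | J. J \<in> \<J>s}
        \<and> rank_flats (E \<union> {m}) Im 2 = (rank_flats E I 2 - \<J>p) \<union> {J \<union> {m} | J. J \<in> \<J>p}
        \<and> rank_flats (E \<union> {m}) Im 1 = rank_flats E I 1 \<union> {{m}})"
proof -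
  interpret disjoint_plane_line E I F L
    using assms by (simp add: disjoint_plane_line_def disjoint_plane_line_axioms_def)
  \<comment> \<open>Index 0 contributes \<open>L\<close>, and the remaining indices run through all
    planes above \<open>L\<close>; hence \<open>\<T>\<close> is \<open>traces\<close>, whatever the
    enumeration.\<close>
  have "{0..n} = insert 0 {1..n}" by auto
  then have "\<T> = insert L ((\<lambda>i. A i \<inter> F) ` {1..n})" using assms(10,11,12) by auto
  moreover have "A ` {1..n} = {H \<in> rank_flats E I 3. L \<subseteq> H}" using assms(9) by (simp add: bij_betw_def)
  then have "(\<lambda>i. A i \<inter> F) ` {1..n} = (\<lambda>H. H \<inter> F) ` {H \<in> rank_flats E I 3. L \<subseteq> H}"
    using image_image[of "\<lambda>H. H \<inter> F" A "{1..n}"] by simp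
  ultimately have T: "\<T> = traces" by (auto simp: traces_def)
  have Jp: "\<J>p = cut_lines" and Js: "\<J>s = cut_planes"
    using assms(13-15) T by (auto simp: cut_lines_def cut_planes_def)
  have Em: "E \<union> {m} = insert m E" by simp
  show ?thesis (is "?span \<longleftrightarrow> ?ext")
  proof
    assume ?span
    interpret coplanar_extension E I F L m
      by unfold_locales (use \<open>?span\<close> Jp Js assms(16) in auto)
    have "matroid (insert m E) Iext" by (rule matroid_extension)
    then show ?ext
      unfolding Em Jp Js
      using rank_ext_total hypermodular_ext mrestrict_Iext total_modular_defect_ext
        rank_flats_ext_4 rank_flats_ext_3 rank_flats_ext_2 rank_flats_ext_1 rank_flats_ext_0
      by blast
  next
    assume ?ext
    then obtain I' where "matroid (insert m E) I'" "mrestrict I' E = I"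
      "rank_flats (insert m E) I' 3 = (planes - cut_planes) \<union> {J \<union> {m} | J. J \<in> cut_planes}"
      "rank_flats (insert m E) I' 2 = (lines - cut_lines) \<union> {J \<union> {m} | J. J \<in> cut_lines}"
      "rank_flats (insert m E) I' 1 = rank_flats E I 1 \<union> {{m}}"
      unfolding Em Jp Js by (elim exE conjE) (rule that)
    note ext = coplanar_if_extension[OF this(1,2) assms(16) this(3-5)]
    show ?span unfolding Jp Js using ext by blast
  qed
qed


end
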